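(* Let $-\infty\le a<b\le\infty$, let $Y$ be a smooth real function on $(a,b)$ with $Y'(x)\neq0$ on $(a,b)$, and let $c_0,c_1,k_0\in\mathbb{R}$ with $k_0\ne0$ and $Y+c_0>0$ on $(a,b)$. For integers $n\geq 0$, let $u_n$ be real functions on $(a,b)$ satisfying $$f_2u_n''+f_1u_n'+f_0u_n=(n+1)u_n,$$ where $$f_2=\frac{k_0}{Y'^2}(Y+c_0),\qquad f_1=\frac{1}{Y'^3}\Big\{\big[Y+c_0+k_0(c_1+3)\big]Y'^2-3k_0(Y+c_0)Y''\Big\},$$ $$f_0=-\frac{1}{Y'^4}\Big\{k_0(Y+c_0)\big(Y'Y'''-3Y''^2\big)+\big[k_0(c_1+3)+Y+c_0\big]Y'^2Y''-(c_1+3)Y'^4\Big\}.$$ Suppose that for all $n,m$ the boundary condition $$\left\{\frac{(Y(x)+c_0)^{c_1+3}}{|Y'(x)|^3}\,e^{Y(x)/k_0}\big(u_m(x)u_n'(x)-u_m'(x)u_n(x)\big)\right\}\Bigg|_a^b=0$$ holds. Then $$\int_a^b w(x)\,u_m(x)\,u_n(x)\,dx=N_{nm}\,\delta_{nm},\qquad w(x)=\frac{(Y(x)+c_0)^{c_1+2}}{|Y'(x)|}\,e^{Y(x)/k_0},$$ for some constants $N_{nm}$; that is, the integral vanishes whenever $n\neq m$.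
   Context: $\{F(x)\}|_a^b=\lim_{x\to b^-}F(x)-\lim_{x\to a^+}F(x)$, with both limits assumed to exist. The integrals $\int_a^b w u_mu_n\,dx$ are assumed to converge. $\delta_{nm}$ is the Kronecker delta. *)

theory Defs
  imports "HOL-Analysis.Analysis"
begin

text \<open>The next two predicates are meant for open sets only: there the iterates of \<^const>\<open>deriv\<close> at
  a point of the set depend only on the restriction of the function to the set, so values outside
  it play no role.\<close>

definition smooth_on_open :: "(real \<Rightarrow> real) \<Rightarrow> real set \<Rightarrow> bool" where
  "smooth_on_open f S \<longleftrightarrow> (\<forall>k. \<forall>x\<in>S. (deriv ^^ k) f differentiable at x)"

definition twice_differentiable_on_open :: "(real \<Rightarrow> real) \<Rightarrow> real set \<Rightarrow> bool" where
  "twice_differentiable_on_open f S \<longleftrightarrow>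
     (\<forall>x\<in>S. f differentiable at x \<and> deriv f differentiable at x)"

text \<open>The limits are taken in the extended reals, so that infinite endpoints are covered
  (as in the library's interval integrals). Existence and finiteness of both limits is part of
  the predicate.\<close>

definition has_boundary_difference ::
    "(real \<Rightarrow> real) \<Rightarrow> ereal \<Rightarrow> ereal \<Rightarrow> real \<Rightarrow> bool" where
  "has_boundary_difference F a b D \<longleftrightarrow>
     (\<exists>A B. ((F \<circ> real_of_ereal) \<longlongrightarrow> A) (at_right a) \<and>
            ((F \<circ> real_of_ereal) \<longlongrightarrow> B) (at_left b) \<and> D = B - A)"

context
  fixes Y :: "real \<Rightarrow> real" and c0 c1 k0 :: real
begin

definition coeff2 :: "real \<Rightarrow> real" where
  "coeff2 x = k0 / (deriv Y x)^2 * (Y x + c0)"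

definition coeff1 :: "real \<Rightarrow> real" where
  "coeff1 x = 1 / (deriv Y x)^3 *
     ((Y x + c0 + k0 * (c1 + 3)) * (deriv Y x)^2
       - 3 * k0 * (Y x + c0) * (deriv ^^ 2) Y x)"

definition coeff0 :: "real \<Rightarrow> real" where
  "coeff0 x = - (1 / (deriv Y x)^4) *
     (k0 * (Y x + c0) * (deriv Y x * (deriv ^^ 3) Y x - 3 * ((deriv ^^ 2) Y x)^2)
       + (k0 * (c1 + 3) + Y x + c0) * (deriv Y x)^2 * (deriv ^^ 2) Y x
       - (c1 + 3) * (deriv Y x)^4)"

definition weight :: "real \<Rightarrow> real" where
  "weight x = (Y x + c0) powr (c1 + 2) / \<bar>deriv Y x\<bar> * exp (Y x / k0)"

definition boundary_factor :: "real \<Rightarrow> real" where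
  "boundary_factor x = (Y x + c0) powr (c1 + 3) / \<bar>deriv Y x\<bar>^3 * exp (Y x / k0)"

end

end

theory Submission
  imports Defs
begin

text \<open>The factor \<open>p\<close> of the boundary condition satisfies \<open>k\<^sub>0 p = w f\<^sub>2\<close> and \<open>k\<^sub>0 p' = w f\<^sub>1\<close>, so multiplying
  the equation by \<open>w / k\<^sub>0\<close> puts it in Sturm--Liouville form \<open>(p u')' + (w / k\<^sub>0) (f\<^sub>0 - (n + 1)) u = 0\<close>.
  By Lagrange's identity \<open>p (u\<^sub>m u\<^sub>n' - u\<^sub>m' u\<^sub>n)\<close> has derivative \<open>(n - m) / k\<^sub>0 \<cdot> w u\<^sub>m u\<^sub>n\<close>, and the fundamental
  theorem of calculus on the open interval makes the integral vanish for \<open>n \<noteq> m\<close>. That theorem is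
  applied to the Henstock--Kurzweil integral: the integrand need not be absolutely integrable.\<close>

text \<open>A form of Hake's theorem for primitives. Continued by the constants \<open>A\<close> and
  \<open>B\<close>, \<open>G\<close> becomes continuous on the whole line and differentiable off the
  finite endpoints. So integrals over boxes are differences of its values, and these tend to
  \<open>B - A\<close> as the boxes exhaust the line. Integrability of \<open>g\<close> is part of
  the conclusion.\<close>

lemma has_integral_einterval_boundary_limits:
  fixes G g :: "real \<Rightarrow> 'a::banach"
  assumes "a < b"
    and deriv: "\<And>x. x \<in> einterval a b \<Longrightarrow> (G has_vector_derivative g x) (at x)"
    and A: "((G \<circ> real_of_ereal) \<longlongrightarrow> A) (at_right a)"
    and B: "((G \<circ> real_of_ereal) \<longlongrightarrow> B) (at_left b)"
  shows "(g has_integral (B - A)) (einterval a b)"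
proof -
  \<comment> \<open>extending \<open>G\<close> by its limits makes bounded and unbounded intervals a single case\<close>
  define H where "H x = (if ereal x \<le> a then A else if b \<le> ereal x then B else G x)" for x
  \<comment> \<open>Zero is the derivative of the two constant continuations, and it turns an
    integral of \<open>g\<close> over the interval into one of \<open>h\<close> over the
    line.\<close>
  define h where "h x = (if x \<in> einterval a b then g x else 0)" for x
  have H_inside: "H x = G x" if "x \<in> einterval a b" for x
    using that by (auto simp: H_def einterval_iff)
  have H_left: "H x = A" if "ereal x \<le> a" for x
    using that by (simp add: H_def)
  have H_right: "H x = B" if "b \<le> ereal x" for x
    using that \<open>a < b\<close> by (auto simp: H_def)
  have H_deriv: "(H has_vector_derivative h x) (at x)" if ne: "ereal x \<noteq> a" "ereal x \<noteq> b" for x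
  proof -
    consider "ereal x < a" | "b < ereal x" | "x \<in> einterval a b"
      using ne unfolding einterval_iff by (metis linorder_less_linear)
    then show ?thesis
    proof cases
      case 1
      have "open {y. ereal y < a}"
        by (intro open_Collect_less continuous_intros)
      moreover have "((\<lambda>_. A) has_vector_derivative h x) (at x)"
        using 1 by (auto simp: h_def einterval_iff)
      ultimately show ?thesis
        using 1 by (auto intro: has_vector_derivative_transform_within_open simp: H_left)
    next
      case 2
      have "open {y. b < ereal y}"
        by (intro open_Collect_less continuous_intros)
      moreover have "((\<lambda>_. B) has_vector_derivative h x) (at x)"
        using 2 by (auto simp: h_def einterval_iff)
      ultimately show ?thesis
        using 2 by (auto intro: has_vector_derivative_transform_within_open simp: H_right)
    next
      case 3
      then have "(G has_vector_derivative h x) (at x)"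
        using deriv by (simp add: h_def)
      then show ?thesis
        by (rule has_vector_derivative_transform_within_open[OF _ _ 3]) (auto simp: H_inside)
    qed
  qed
  \<comment> \<open>This only concerns a finite endpoint. From the right \<open>H\<close> inherits
    the limit of \<open>G\<close>; from the left it is constantly \<open>A\<close>. The point
    \<open>s\<close> below keeps the right neighbourhood clear of \<open>b\<close>.\<close>
  have H_at_a: "isCont H r" if r: "ereal r = a" for r
  proof -
    have "(G \<longlongrightarrow> A) (at_right r)"
      using A by (simp add: r[symmetric] ereal_tendsto_simps)
    moreover have "eventually (\<lambda>x. G x = H x) (at_right r)"
    proof -
      obtain s where s: "r < s" "ereal s < b"
        using ereal_dense2[of a b] \<open>a < b\<close> r by auto
      have "G x = H x" if "x \<in> {r<..<s}" for x
        using that s less_trans[of "ereal x" "ereal s" b] by (simp add: r[symmetric] H_inside einterval_iff)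
      then show ?thesis
        using eventually_at_right_real[OF s(1)] by (rule eventually_mono[rotated])
    qed
    ultimately have "(H \<longlongrightarrow> A) (at_right r)"
      by (rule Lim_transform_eventually)
    moreover have "(H \<longlongrightarrow> A) (at_left r)"
      by (rule tendsto_eventually) (use r in \<open>auto simp: eventually_at_filter intro!: always_eventually H_left\<close>)
    ultimately have "(H \<longlongrightarrow> A) (at r)"
      by (simp add: filterlim_at_split)
    then show ?thesis
      using r by (simp add: isCont_def H_left)
  qed
  have H_at_b: "isCont H r" if r: "ereal r = b" for r
  proof -
    have "(G \<longlongrightarrow> B) (at_left r)"
      using B by (simp add: r[symmetric] ereal_tendsto_simps)
    moreover have "eventually (\<lambda>x. G x = H x) (at_left r)"
    proof -
      obtain s where s: "a < ereal s" "s < r"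
        using ereal_dense2[of a b] \<open>a < b\<close> r by auto
      have "G x = H x" if "x \<in> {s<..<r}" for x
        using that s less_trans[of a "ereal s" "ereal x"] by (simp add: r[symmetric] H_inside einterval_iff)
      then show ?thesis
        using eventually_at_left_real[OF s(2)] by (rule eventually_mono[rotated])
    qed
    ultimately have "(H \<longlongrightarrow> B) (at_left r)"
      by (rule Lim_transform_eventually)
    moreover have "(H \<longlongrightarrow> B) (at_right r)"
      by (rule tendsto_eventually) (use r in \<open>auto simp: eventually_at_filter intro!: always_eventually H_right\<close>)
    ultimately have "(H \<longlongrightarrow> B) (at r)"
      by (simp add: filterlim_at_split)
    then show ?thesis
      using r by (simp add: isCont_def H_right)
  qed
  have H_cont: "isCont H x" for x
    using H_at_a H_at_b H_deriv has_vector_derivative_continuous by metis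
  have FTC: "(h has_integral (H d - H c)) (cbox c d)" if "c \<le> d" for c d
  proof -
    \<comment> \<open>The strong fundamental theorem tolerates a finite exceptional set on which the
      primitive is merely continuous. An infinite endpoint is sent to 0 by
      \<open>real_of_ereal\<close>, which only enlarges the bounding set.\<close>
    have "{x. ereal x = a \<or> ereal x = b} \<subseteq> {real_of_ereal a, real_of_ereal b}"
      by auto
    then have "finite {x. ereal x = a \<or> ereal x = b}"
      using finite_subset by blast
    then show ?thesis
      unfolding interval_cbox[symmetric]
      by (rule fundamental_theorem_of_calculus_strong[OF _ that])
         (use H_deriv H_cont in \<open>auto intro: continuous_at_imp_continuous_on\<close>)
  qed
  \<comment> \<open>If \<open>a\<close> is finite, \<open>H\<close> is constant far to the left; if
    it is minus infinity, the limit at \<open>a\<close> is itself a limit at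
    \<open>at_bot\<close>.\<close>
  have H_bot: "(H \<longlongrightarrow> A) at_bot"
  proof (cases a)
    case (real r)
    then have "eventually (\<lambda>x. H x = A) at_bot"
      by (auto simp: eventually_at_bot_linorder intro!: exI[of _ r] H_left)
    then show ?thesis
      by (rule tendsto_eventually)
  next
    case MInf
    have lim: "(G \<longlongrightarrow> A) at_bot"
      using A by (simp add: MInf ereal_tendsto_simps)
    obtain s where s: "ereal s < b"
      using ereal_dense2[of a b] \<open>a < b\<close> by blast
    have "eventually (\<lambda>x. x \<le> s) at_bot"
      by (rule eventually_le_at_bot)
    then have "eventually (\<lambda>x. G x = H x) at_bot"
    proof eventually_elim
      case (elim x)
      then have "ereal x < b"
        using s by (meson ereal_less_eq(3) le_less_trans)
      then show ?case
        using MInf by (simp add: H_inside einterval_iff)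
    qed
    with lim show ?thesis
      by (rule Lim_transform_eventually)
  qed (use \<open>a < b\<close> in auto)
  have H_top: "(H \<longlongrightarrow> B) at_top"
  proof (cases b)
    case (real r)
    then have "eventually (\<lambda>x. H x = B) at_top"
      by (auto simp: eventually_at_top_linorder intro!: exI[of _ r] H_right)
    then show ?thesis
      by (rule tendsto_eventually)
  next
    case PInf
    have lim: "(G \<longlongrightarrow> B) at_top"
      using B by (simp add: PInf ereal_tendsto_simps)
    obtain s where s: "a < ereal s"
      using ereal_dense2[of a b] \<open>a < b\<close> by blast
    have "eventually (\<lambda>x. s \<le> x) at_top"
      by (rule eventually_ge_at_top)
    then have "eventually (\<lambda>x. G x = H x) at_top"
    proof eventually_elim
      case (elim x)
      then have "a < ereal x"
        using s by (meson ereal_less_eq(3) less_le_trans)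
      then show ?case
        using PInf by (simp add: H_inside einterval_iff)
    qed
    with lim show ?thesis
      by (rule Lim_transform_eventually)
  qed (use \<open>a < b\<close> in auto)
  \<comment> \<open>Over the line it suffices that \<open>h\<close> is integrable on every box and
    that its integrals over all boxes containing a large ball are close to
    \<open>B - A\<close>.\<close>
  have "(h has_integral (B - A)) UNIV"
    unfolding has_integral_alt'[of h]
  proof (intro conjI allI impI)
    fix c d :: real
    show "(\<lambda>x. if x \<in> UNIV then h x else 0) integrable_on cbox c d"
      using FTC[of c d] by (cases "c \<le> d") auto
  next
    fix e :: real
    assume "e > 0"
    then have "eventually (\<lambda>x. dist (H x) A < e / 2) at_bot"
      "eventually (\<lambda>x. dist (H x) B < e / 2) at_top"
      using tendstoD[OF H_bot] tendstoD[OF H_top] half_gt_zero by blast+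
    then obtain p q where p: "\<And>x. x \<le> p \<Longrightarrow> dist (H x) A < e / 2"
      and q: "\<And>x. x \<ge> q \<Longrightarrow> dist (H x) B < e / 2"
      by (auto simp: eventually_at_bot_linorder eventually_at_top_linorder)
    \<comment> \<open>A box containing the ball of this radius contains \<open>p\<close> and
      \<open>q\<close>, so its ends lie where \<open>H\<close> is within \<open>e / 2\<close> of its
      limits. The summand 1 makes the radius positive.\<close>
    define R where "R = 1 + \<bar>p\<bar> + \<bar>q\<bar>"
    have "norm (integral (cbox c d) h - (B - A)) < e" if "ball 0 R \<subseteq> cbox c d" for c d :: real
    proof -
      have "p \<in> ball 0 R" "q \<in> ball 0 R"
        by (auto simp: R_def)
      then have "c \<le> p" "p \<le> d" "q \<le> d"
        using that by (auto simp: subset_iff)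
      then have "norm (H c - A) < e / 2" "norm (H d - B) < e / 2" "c \<le> d"
        using p q by (auto simp: dist_norm)
      moreover have "norm (H d - H c - (B - A)) \<le> norm (H d - B) + norm (H c - A)"
        using norm_triangle_ineq4[of "H d - B" "H c - A"] by (simp add: algebra_simps)
      ultimately show ?thesis
        using integral_unique[OF FTC] by simp
    qed
    then show "\<exists>R>0. \<forall>c d. ball 0 R \<subseteq> cbox c d \<longrightarrow>
        norm (integral (cbox c d) (\<lambda>x. if x \<in> UNIV then h x else 0) - (B - A)) < e"
      by (intro exI[of _ R]) (auto simp: R_def)
  qed
  then show ?thesis
    by (simp add: h_def[abs_def] has_integral_restrict_UNIV)
qed

lemma boundary_factor_coeff2:
  assumes "deriv Y x \<noteq> 0" "Y x + c0 > 0"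
  shows "k0 * boundary_factor Y c0 c1 k0 x = weight Y c0 c1 k0 x * coeff2 Y c0 k0 x"
proof -
  have "(Y x + c0) powr (c1 + 3) = (Y x + c0) powr (c1 + 2) * (Y x + c0)"
    using assms(2) powr_add[of "Y x + c0" "c1 + 2" 1] by (simp add: add.commute)
  then show ?thesis
    using assms(1)
    by (simp add: boundary_factor_def weight_def coeff2_def field_simps power2_eq_square power3_eq_cube)
qed

lemma has_real_derivative_abs:
  assumes "x \<noteq> 0"
  shows "(abs has_real_derivative sgn x) (at (x::real))"
proof -
  have "((\<lambda>y. sgn x * y) has_real_derivative sgn x) (at x)"
    by (auto intro!: derivative_eq_intros)
  moreover have "open (if x > 0 then {0<..} else {..<0::real})"
    by simp
  ultimately show ?thesis
    by (rule has_field_derivative_transform_within_open)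
       (use assms in \<open>auto simp: sgn_if split: if_splits\<close>)
qed

text \<open>The logarithmic derivative of p is (c1 + 3) Y' / (Y + c0) - 3 Y'' / Y' + Y' / k0.
  Multiplied by f2 it gives f1, so p' = p f1 / f2 = w f1 / k0.\<close>

lemma boundary_factor_has_real_derivative:
  assumes Y: "Y differentiable at x" "deriv Y differentiable at x"
    and nz: "k0 \<noteq> 0" "deriv Y x \<noteq> 0" and pos: "Y x + c0 > 0"
  shows "(boundary_factor Y c0 c1 k0 has_real_derivative
           weight Y c0 c1 k0 x * coeff1 Y c0 c1 k0 x / k0) (at x)"
proof -
  have Y1: "(Y has_real_derivative deriv Y x) (at x)"
    and Y2: "(deriv Y has_real_derivative deriv (deriv Y) x) (at x)"
    using Y by (simp_all add: DERIV_deriv_iff_real_differentiable)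
  have p3: "(Y x + c0) powr (c1 + 3) = (Y x + c0) powr (c1 + 2) * (Y x + c0)"
    using pos powr_add[of "Y x + c0" "c1 + 2" 1] by (simp add: add.commute)
  have pow: "((\<lambda>x. (Y x + c0) powr (c1 + 3)) has_real_derivative
      (c1 + 3) * (Y x + c0) powr (c1 + 2) * deriv Y x) (at x)"
    using DERIV_fun_powr[of "\<lambda>x. Y x + c0" "deriv Y x" x "c1 + 3"] Y1 pos
    by (auto intro!: derivative_eq_intros simp: algebra_simps)
  have abs: "((\<lambda>x. \<bar>deriv Y x\<bar>) has_real_derivative sgn (deriv Y x) * deriv (deriv Y) x) (at x)"
    using DERIV_chain2[OF has_real_derivative_abs[OF nz(2)] Y2] .
  have D: "(boundary_factor Y c0 c1 k0 has_real_derivative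
      (((c1 + 3) * (Y x + c0) powr (c1 + 2) * deriv Y x) * \<bar>deriv Y x\<bar> ^ 3
        - (Y x + c0) powr (c1 + 3) * (3 * \<bar>deriv Y x\<bar>\<^sup>2 * (sgn (deriv Y x) * deriv (deriv Y) x)))
        / (\<bar>deriv Y x\<bar> ^ 3 * \<bar>deriv Y x\<bar> ^ 3) * exp (Y x / k0)
      + (Y x + c0) powr (c1 + 3) / \<bar>deriv Y x\<bar> ^ 3 * (exp (Y x / k0) * (deriv Y x / k0))) (at x)"
    unfolding boundary_factor_def[abs_def]
    by (rule derivative_eq_intros Y1 pow abs refl | use nz in \<open>simp; fail\<close>)+
       (simp add: algebra_simps)
  \<comment> \<open>Here \<open>P\<close>, \<open>Z\<close>, \<open>d\<close>, \<open>s\<close>,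
    \<open>E\<close> stand for the power in the weight, Y + c0, Y', Y'' and the exponential. Fixing
    the sign of \<open>d\<close> removes \<open>abs\<close> and \<open>sgn\<close>, leaving a
    rational identity.\<close>
  have alg: "((c1 + 3) * P * d * \<bar>d\<bar> ^ 3 - P * Z * (3 * \<bar>d\<bar>\<^sup>2 * (sgn d * s))) / (\<bar>d\<bar> ^ 3 * \<bar>d\<bar> ^ 3) * E
        + P * Z / \<bar>d\<bar> ^ 3 * (E * (d / k0))
      = P / \<bar>d\<bar> * E * (1 / d ^ 3 * ((Z + k0 * (c1 + 3)) * d\<^sup>2 - 3 * k0 * Z * s)) / k0"
    if "d \<noteq> 0" for P Z d s E :: real
    using that nz(1) by (cases "d > 0") (simp_all add: sgn_if field_simps eval_nat_numeral)
  have "(deriv ^^ 2) Y x = deriv (deriv Y) x"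
    by (simp add: eval_nat_numeral)
  then show ?thesis
    using D alg[OF nz(2), of "(Y x + c0) powr (c1 + 2)" "Y x + c0" "deriv (deriv Y) x" "exp (Y x / k0)"]
    by (simp only: weight_def coeff1_def p3)
qed

theorem theorem3:
  fixes a b :: ereal and Y :: "real \<Rightarrow> real" and c0 c1 k0 :: real
    and u :: "nat \<Rightarrow> real \<Rightarrow> real"
  assumes "a < b"
    and "smooth_on_open Y (einterval a b)"
    and "\<And>x. x \<in> einterval a b \<Longrightarrow> deriv Y x \<noteq> 0"
    and "k0 \<noteq> 0"
    and "\<And>x. x \<in> einterval a b \<Longrightarrow> Y x + c0 > 0"
    and "\<And>n. twice_differentiable_on_open (u n) (einterval a b)"
    and "\<And>n x. x \<in> einterval a b \<Longrightarrow>
           coeff2 Y c0 k0 x * (deriv ^^ 2) (u n) x + coeff1 Y c0 c1 k0 x * deriv (u n) x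
             + coeff0 Y c0 c1 k0 x * u n x = (real n + 1) * u n x"
    and "\<And>n m. has_boundary_difference
           (\<lambda>x. boundary_factor Y c0 c1 k0 x * (u m x * deriv (u n) x - deriv (u m) x * u n x))
           a b 0"
    and "\<And>n m. (\<lambda>x. weight Y c0 c1 k0 x * u m x * u n x) integrable_on einterval a b"
  shows "(\<exists>N :: nat \<Rightarrow> nat \<Rightarrow> real. \<forall>n m.
            integral (einterval a b) (\<lambda>x. weight Y c0 c1 k0 x * u m x * u n x)
              = N n m * (if n = m then 1 else 0)) \<and>
         (\<forall>n m. n \<noteq> m \<longrightarrow>
            integral (einterval a b) (\<lambda>x. weight Y c0 c1 k0 x * u m x * u n x) = 0)"
proof -
  have orthogonal: "integral (einterval a b) (\<lambda>x. weight Y c0 c1 k0 x * u m x * u n x) = 0"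
    if "n \<noteq> m" for n m
  proof -
    let ?w = "weight Y c0 c1 k0" and ?p = "boundary_factor Y c0 c1 k0"
    let ?G = "\<lambda>x. ?p x * (u m x * deriv (u n) x - deriv (u m) x * u n x)"
    let ?c = "(real n - real m) / k0"
    have "(?G has_real_derivative ?c * (?w x * u m x * u n x)) (at x)" if x: "x \<in> einterval a b" for x
    proof -
      have Y: "Y differentiable at x" "deriv Y differentiable at x"
        using assms(2)[unfolded smooth_on_open_def, rule_format, of x 0]
          assms(2)[unfolded smooth_on_open_def, rule_format, of x 1] x by simp_all
      have u1: "(u i has_real_derivative deriv (u i) x) (at x)"
        and u2: "(deriv (u i) has_real_derivative (deriv ^^ 2) (u i) x) (at x)" for i
        using assms(6)[of i] x
        by (simp_all add: twice_differentiable_on_open_def DERIV_deriv_iff_real_differentiable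
            eval_nat_numeral)
      have p: "(?p has_real_derivative ?w x * coeff1 Y c0 c1 k0 x / k0) (at x)"
        using boundary_factor_has_real_derivative[OF Y] assms(3-5) x by blast
      have p_eq: "?p x = ?w x * coeff2 Y c0 k0 x / k0"
        using boundary_factor_coeff2[OF assms(3)[OF x] assms(5)[OF x]] assms(4)
        by (simp add: field_simps)
      note ode = assms(7)[OF x]
      \<comment> \<open>The terms with \<open>coeff0\<close> cancel between the two products on the
        right, so they may be inserted to complete both differential expressions. The eigenvalues n
        + 1 and m + 1 then leave the factor n - m.\<close>
      have "?w x * coeff1 Y c0 c1 k0 x / k0 * (u m x * deriv (u n) x - deriv (u m) x * u n x)
          + ?p x * (u m x * (deriv ^^ 2) (u n) x - (deriv ^^ 2) (u m) x * u n x)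
        = ?w x / k0 * (u m x * (coeff2 Y c0 k0 x * (deriv ^^ 2) (u n) x + coeff1 Y c0 c1 k0 x * deriv (u n) x
              + coeff0 Y c0 c1 k0 x * u n x)
            - (coeff2 Y c0 k0 x * (deriv ^^ 2) (u m) x + coeff1 Y c0 c1 k0 x * deriv (u m) x
              + coeff0 Y c0 c1 k0 x * u m x) * u n x)"
        unfolding p_eq using assms(4) by (simp add: field_simps)
      also have "\<dots> = ?c * (?w x * u m x * u n x)"
        unfolding ode using assms(4) by (simp add: field_simps)
      finally have "?w x * coeff1 Y c0 c1 k0 x / k0 * (u m x * deriv (u n) x - deriv (u m) x * u n x)
          + ?p x * (u m x * (deriv ^^ 2) (u n) x - (deriv ^^ 2) (u m) x * u n x)
        = ?c * (?w x * u m x * u n x)" .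
      \<comment> \<open>The product rule yields u_m' u_n' twice with opposite signs, so only second
        derivatives remain beside \<open>?p x\<close>.\<close>
      moreover have "(?G has_real_derivative
          ?w x * coeff1 Y c0 c1 k0 x / k0 * (u m x * deriv (u n) x - deriv (u m) x * u n x)
          + ?p x * (u m x * (deriv ^^ 2) (u n) x - (deriv ^^ 2) (u m) x * u n x)) (at x)"
        by (rule derivative_eq_intros p u1 u2 refl)+ (simp add: algebra_simps)
      ultimately show ?thesis
        by simp
    qed
    \<comment> \<open>Boundary difference 0 means that the two one-sided limits share one
      value.\<close>
    moreover obtain A where "((?G \<circ> real_of_ereal) \<longlongrightarrow> A) (at_right a)"
      "((?G \<circ> real_of_ereal) \<longlongrightarrow> A) (at_left b)"
      using assms(8)[where n = n and m = m] unfolding has_boundary_difference_def by auto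
    ultimately have "((\<lambda>x. ?c * (?w x * u m x * u n x)) has_integral (A - A)) (einterval a b)"
      by (intro has_integral_einterval_boundary_limits[OF \<open>a < b\<close>])
         (auto simp: has_real_derivative_iff_has_vector_derivative)
    then have "?c * integral (einterval a b) (\<lambda>x. ?w x * u m x * u n x) = 0"
      using integral_unique[of "\<lambda>x. ?c * (?w x * u m x * u n x)"]
      unfolding integral_mult_right by simp
    then show ?thesis
      using that assms(4) by simp
  qed
  then show ?thesis
    \<comment> \<open>The integral itself serves as N: on the diagonal the Kronecker factor is 1,
      and off it both sides are 0.\<close>
    by (intro conjI exI[of _ "\<lambda>n m. integral (einterval a b) (\<lambda>x. weight Y c0 c1 k0 x * u m x * u n x)"]) auto
qed

end
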